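(* Let $1<p<\infty$ and $\frac1p+\frac1q=1$, and let $g$ be an outer function in $H^p$. If there exists $s>q$ such that $1/g\in L^s(\mathbb{T})$, then for $r$ defined by $\frac1r=\frac1p+\frac1s$ we have $L^p(|g|^p)\subset L^r(\mathbb{T})$.
   Context: $\mathbb{T}$ is the unit circle with normalized Lebesgue measure $m$, and $H^p$ is the Hardy space of the unit disk, with functions identified with their boundary values on $\mathbb{T}$. $L^p(|g|^p)$ is the space of measurable functions $f$ on $\mathbb{T}$ with $\int_{\mathbb{T}}|f|^p|g|^p\,dm<\infty$. *)

theory Defs
  imports "HOL-Complex_Analysis.Complex_Analysis" "HOL-Probability.Probability"
begin

text \<open>Normalized Lebesgue measure on the unit circle. Its space is the circle, so the
  values of functions off the circle are irrelevant; the completion makes measurability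
  mean Lebesgue measurability.\<close>

definition circle_measure :: "complex measure" where
  "circle_measure =
     completion (distr (uniform_measure lborel {0..<2 * pi}) (restrict_space borel (sphere 0 1)) cis)"

definition Lp :: "'a measure \<Rightarrow> real \<Rightarrow> ('a \<Rightarrow> complex) set" where
  "Lp M p = {f \<in> borel_measurable M. (\<integral>\<^sup>+x. ennreal (norm (f x) powr p) \<partial>M) < \<infinity>}"

definition weighted_Lp :: "'a measure \<Rightarrow> real \<Rightarrow> ('a \<Rightarrow> real) \<Rightarrow> ('a \<Rightarrow> complex) set" where
  "weighted_Lp M p w =
     {f \<in> borel_measurable M. (\<integral>\<^sup>+x. ennreal (norm (f x) powr p * w x) \<partial>M) < \<infinity>}"

definition Hardy_disc :: "real \<Rightarrow> (complex \<Rightarrow> complex) set" where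
  "Hardy_disc p =
     {G. G holomorphic_on ball 0 1 \<and>
         (SUP \<rho>\<in>{0..<1::real}. \<integral>\<^sup>+\<zeta>. ennreal (norm (G (of_real \<rho> * \<zeta>)) powr p) \<partial>circle_measure) < \<infinity>}"

definition outer_function :: "(complex \<Rightarrow> complex) \<Rightarrow> bool" where
  "outer_function G \<longleftrightarrow>
     (\<exists>c \<phi>. norm c = 1 \<and>
        \<phi> \<in> borel_measurable circle_measure \<and> (\<forall>\<zeta>\<in>sphere 0 1. \<phi> \<zeta> > 0) \<and>
        integrable circle_measure (\<lambda>\<zeta>. ln (\<phi> \<zeta>)) \<and>
        (\<forall>z\<in>ball 0 1. G z =
           c * exp (\<integral>\<zeta>. (\<zeta> + z) / (\<zeta> - z) * complex_of_real (ln (\<phi> \<zeta>)) \<partial>circle_measure)))"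

definition has_boundary_values :: "(complex \<Rightarrow> complex) \<Rightarrow> (complex \<Rightarrow> complex) \<Rightarrow> bool" where
  "has_boundary_values G g \<longleftrightarrow>
     (AE \<zeta> in circle_measure. ((\<lambda>\<rho>. G (of_real \<rho> * \<zeta>)) \<longlongrightarrow> g \<zeta>) (at_left 1))"

text \<open>Functions on the circle, identified with the functions on the disc of which they are the
  radial boundary values. Those exist almost everywhere for every function in the Hardy space
  by Fatou's theorem, so every outer function in the Hardy space is represented here.\<close>

definition Hardy_outer :: "real \<Rightarrow> (complex \<Rightarrow> complex) set" where
  "Hardy_outer p =
     {g. \<exists>G \<in> Hardy_disc p. outer_function G \<and> has_boundary_values G g}"

end

theory Submission
  imports Defs
begin

text \<open>
  Off the zeros of \<open>g\<close> one has \<open>f = (f g) (1/g)\<close>, a product of an \<open>L\<^sup>p\<close> function and an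
  \<open>L\<^sup>s\<close> function, so Hoelder's inequality with \<open>1/r = 1/p + 1/s\<close> puts \<open>f\<close> into \<open>L\<^sup>r\<close>. Only finiteness
  of the integral matters, so the pointwise bound \<open>A\<^sup>a B\<^sup>b \<le> A + B\<close> for \<open>a + b = 1\<close>, applied to
  \<open>A = |f g|\<^sup>p\<close> and \<open>B = |1/g|\<^sup>s\<close>, replaces the sharp inequality.

  Since \<open>1 / 0 = 0\<close>, the integrability of \<open>1/g\<close> says nothing about the zeros of \<open>g\<close>, and the
  weighted condition does not see \<open>f\<close> there. The substance of the proof is therefore that an
  outer function has nonzero radial limits almost everywhere. If \<open>G\<close> is outer with
  \<open>h = ln \<phi>\<close> in \<open>L\<^sup>1\<close>, then \<open>ln |G|\<close> is the Poisson integral of \<open>h\<close>, and so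
  \<open>|ln |G||\<close> is at most the Poisson integral of \<open>|h|\<close>. By Tonelli and the mean value property
  the latter has mean \<open>\<parallel>h\<parallel>\<^sub>1\<close> on every circle \<open>|z| = \<rho> < 1\<close>. Fatou's lemma along radii
  increasing to 1 makes its lower limit finite along almost every radius
  (\<open>AE_liminf_poisson_integral_finite\<close>), whereas a radial limit 0 of \<open>G\<close> would force
  \<open>ln |G|\<close> to \<open>-\<infinity>\<close> (\<open>outer_function_boundary_values_nonzero\<close>).
\<close>

section \<open>Integration over the unit circle\<close>

lemma cis_measurable_circle:
  "cis \<in> uniform_measure lborel {0..<2 * pi} \<rightarrow>\<^sub>M restrict_space borel (sphere 0 1)"
proof -
  have "cis \<in> borel_measurable borel"
    by (intro borel_measurable_continuous_onI continuous_intros)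
  moreover have "uniform_measure lborel {0..<2 * pi} \<rightarrow>\<^sub>M borel = borel \<rightarrow>\<^sub>M (borel :: complex measure)"
    by (rule measurable_cong_sets) simp_all
  ultimately show ?thesis
    by (intro measurable_restrict_space2) simp_all
qed

lemma space_circle_measure [simp]: "space circle_measure = sphere 0 1"
  by (simp add: circle_measure_def space_restrict_space)

lemma prob_space_circle_measure: "prob_space circle_measure"
  unfolding circle_measure_def
  by (intro prob_space.prob_space_completion prob_space.prob_space_distr
        prob_space_uniform_measure cis_measurable_circle) auto

text \<open>This lets every Borel expression in the point of the circle be used in spite of the
  completion.\<close>

lemma id_measurable_circle: "(\<lambda>\<zeta>. \<zeta>) \<in> borel_measurable circle_measure"
  unfolding circle_measure_def
  by (intro measurable_completion) (simp add: measurable_restrict_space1)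

text \<open>Passes from the circle to the parametrization by arguments, where the contour integral of
  Cauchy's formula lives.\<close>

lemma nn_integral_circle_measure:
  assumes "continuous_on (sphere 0 1) F" and "\<And>\<zeta>. norm \<zeta> = 1 \<Longrightarrow> 0 \<le> F \<zeta>"
    and "((\<lambda>t. F (cis t)) has_integral I) {0..2 * pi}"
  shows "(\<integral>\<^sup>+\<zeta>. ennreal (F \<zeta>) \<partial>circle_measure) = ennreal (I / (2 * pi))"
proof -
  have F: "(\<lambda>\<zeta>. ennreal (F \<zeta>)) \<in> borel_measurable (restrict_space borel (sphere 0 1))"
    using assms(1) by (intro measurable_compose[OF _ measurable_ennreal]
        borel_measurable_continuous_on_restrict)
  have Fcis: "(\<lambda>t. ennreal (F (cis t))) \<in> borel_measurable lborel"
    using measurable_compose[OF cis_measurable_circle F]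
    by simp
  have I: "((\<lambda>t. F (cis t)) has_integral I) {0..<2 * pi}"
    using assms(3) by (rule has_integral_spike_set_eq[THEN iffD1, rotated 2])
      (auto intro: negligible_subset[of "{2 * pi}"])
  have "0 \<le> I"
    using assms(2) by (intro has_integral_nonneg[OF I]) auto
  have "(\<integral>\<^sup>+\<zeta>. ennreal (F \<zeta>) \<partial>circle_measure)
      = (\<integral>\<^sup>+t. ennreal (F (cis t)) \<partial>uniform_measure lborel {0..<2 * pi})"
    unfolding circle_measure_def nn_integral_completion
    by (rule nn_integral_distr[OF cis_measurable_circle]) (use F in simp)
  also have "\<dots> = (\<integral>\<^sup>+t. ennreal (F (cis t)) * indicator {0..<2 * pi} t \<partial>lborel) / ennreal (2 * pi)"
    by (subst nn_integral_uniform_measure[OF Fcis]) auto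
  also have "(\<integral>\<^sup>+t. ennreal (F (cis t)) * indicator {0..<2 * pi} t \<partial>lborel) = ennreal I"
    using assms(2) by (intro nn_integral_has_integral_lebesgue'[OF _ I]) auto
  finally show ?thesis
    using \<open>0 \<le> I\<close> by (simp add: divide_ennreal)
qed

text \<open>Cauchy's integral formula at the centre: on the circle the factor \<open>1 / u\<close> cancels the
  derivative \<open>\<i> \<rho> cis t\<close> of the parametrization up to \<open>\<i>\<close>.\<close>

lemma circle_mean_value:
  fixes f :: "complex \<Rightarrow> complex"
  assumes "f holomorphic_on ball 0 1" "0 < \<rho>" "\<rho> < 1"
  shows "((\<lambda>t. f (of_real \<rho> * cis t)) has_integral 2 * pi * f 0) {0..2 * pi}"
proof -
  have "f holomorphic_on cball 0 \<rho>"
    by (rule holomorphic_on_subset[OF assms(1)]) (use assms in auto)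
  then have "((\<lambda>u. f u / (u - 0)) has_contour_integral (2 * of_real pi * \<i> * f 0)) (circlepath 0 \<rho>)"
    using assms by (intro Cauchy_integral_circlepath_simple) auto
  then have "((\<lambda>t. f (of_real \<rho> * cis t) / (of_real \<rho> * cis t) * \<rho> * \<i> * cis t)
      has_integral 2 * of_real pi * \<i> * f 0) {0..2 * pi}"
    unfolding circlepath_def by (subst (asm) has_contour_integral_part_circlepath_iff) simp_all
  then have "((\<lambda>t. \<i> * f (of_real \<rho> * cis t)) has_integral \<i> * (2 * of_real pi * f 0)) {0..2 * pi}"
    by (rule has_integral_eq_rhs[OF has_integral_eq, rotated]) (use assms in \<open>auto simp: field_simps\<close>)
  from has_integral_mult_right[OF this, of "-\<i>"] show ?thesis
    by (simp flip: mult.assoc)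
qed

section \<open>The Poisson kernel\<close>

text \<open>For \<open>|\<xi>| = 1\<close> this is the usual quotient \<open>(1 - |z|\<^sup>2) / |\<xi> - z|\<^sup>2\<close>.\<close>

definition poisson_kernel :: "complex \<Rightarrow> complex \<Rightarrow> real" where
  "poisson_kernel z \<xi> = Re ((\<xi> + z) / (\<xi> - z))"

lemma poisson_kernel_nonneg:
  assumes "norm z < 1" "norm \<xi> = 1"
  shows "0 \<le> poisson_kernel z \<xi>"
proof -
  \<comment> \<open>The last bracket is purely imaginary.\<close>
  have "(\<xi> + z) * cnj (\<xi> - z) = \<xi> * cnj \<xi> - z * cnj z + (z * cnj \<xi> - cnj (z * cnj \<xi>))"
    by (simp add: algebra_simps)
  then have "Re ((\<xi> + z) * cnj (\<xi> - z)) = (norm \<xi>)\<^sup>2 - (norm z)\<^sup>2"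
    unfolding complex_norm_square[symmetric] by simp
  moreover have "(norm z)\<^sup>2 \<le> 1"
    using assms by (simp add: power_le_one)
  ultimately show ?thesis
    using assms unfolding poisson_kernel_def complex_div_cnj[of "\<xi> + z"]
    by (metis (no_types) Re_divide_of_real diff_ge_0_iff_ge divide_nonneg_nonneg of_real_power
        one_power2 zero_le_power2)
qed

text \<open>The kernel is harmonic in \<open>z\<close> with value 1 at the origin. The integration variable is the
  argument \<open>z = \<rho> \<zeta>\<close> rather than the pole \<open>\<xi>\<close>, as the exchange of integrals in Tonelli's
  theorem requires.\<close>

lemma poisson_kernel_circle_mean:
  assumes "0 < \<rho>" "\<rho> < 1" "norm \<xi> = 1"
  shows "(\<integral>\<^sup>+\<zeta>. ennreal (poisson_kernel (of_real \<rho> * \<zeta>) \<xi>) \<partial>circle_measure) = 1"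
proof -
  have ne: "\<xi> - z \<noteq> 0" if "norm z < 1" for z
    using that assms by auto
  have small: "norm (of_real \<rho> * \<zeta>) < 1" if "norm \<zeta> = 1" for \<zeta> :: complex
    using that assms by (simp add: norm_mult)
  have "((\<lambda>t. (\<xi> + of_real \<rho> * cis t) / (\<xi> - of_real \<rho> * cis t))
      has_integral 2 * pi * ((\<xi> + 0) / (\<xi> - 0))) {0..2 * pi}"
    using ne by (intro circle_mean_value[where f = "\<lambda>z. (\<xi> + z) / (\<xi> - z)"]
        holomorphic_intros assms) auto
  from has_integral_Re[OF this] have "((\<lambda>t. poisson_kernel (of_real \<rho> * cis t) \<xi>) has_integral 2 * pi) {0..2 * pi}"
    using assms ne[of 0] by (auto simp: poisson_kernel_def)
  then have "(\<integral>\<^sup>+\<zeta>. ennreal (poisson_kernel (of_real \<rho> * \<zeta>) \<xi>) \<partial>circle_measure) = ennreal (2 * pi / (2 * pi))"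
  proof (intro nn_integral_circle_measure)
    show "continuous_on (sphere 0 1) (\<lambda>\<zeta>. poisson_kernel (of_real \<rho> * \<zeta>) \<xi>)"
      unfolding poisson_kernel_def using ne small by (intro continuous_intros) auto
  qed (use small poisson_kernel_nonneg assms in auto)
  then show ?thesis by simp
qed

lemma poisson_kernel_measurable_pair:
  assumes [measurable]: "h \<in> borel_measurable circle_measure"
  shows "(\<lambda>(\<zeta>, \<xi>). ennreal (poisson_kernel (of_real \<rho> * \<zeta>) \<xi> * \<bar>h \<xi>\<bar>))
    \<in> borel_measurable (circle_measure \<Otimes>\<^sub>M circle_measure)"
proof -
  have [measurable]: "fst \<in> borel_measurable (circle_measure \<Otimes>\<^sub>M circle_measure)"
      "snd \<in> borel_measurable (circle_measure \<Otimes>\<^sub>M circle_measure)"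
    by (rule measurable_compose[OF measurable_fst id_measurable_circle]
        measurable_compose[OF measurable_snd id_measurable_circle])+
  have [measurable]: "(\<lambda>x. h (snd x)) \<in> borel_measurable (circle_measure \<Otimes>\<^sub>M circle_measure)"
    by (rule measurable_compose[OF measurable_snd assms])
  show ?thesis
    unfolding poisson_kernel_def case_prod_beta by measurable
qed

text \<open>The Poisson integrals of \<open>|h|\<close> all have mean \<open>\<parallel>h\<parallel>\<^sub>1\<close> by Tonelli, hence by Fatou's lemma
  their lower limit is integrable.\<close>

lemma AE_liminf_poisson_integral_finite:
  fixes h :: "complex \<Rightarrow> real"
  assumes h: "integrable circle_measure h" and \<rho>: "\<And>n. 0 < \<rho> n" "\<And>n. \<rho> n < 1"
  shows "AE \<zeta> in circle_measure. liminf (\<lambda>n. \<integral>\<^sup>+\<xi>. ennreal (poisson_kernel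
    (of_real (\<rho> n) * \<zeta>) \<xi> * \<bar>h \<xi>\<bar>) \<partial>circle_measure) < \<infinity>"
proof -
  interpret prob_space circle_measure by (rule prob_space_circle_measure)
  interpret pair_sigma_finite circle_measure circle_measure ..
  define U where "U n \<zeta> = (\<integral>\<^sup>+\<xi>. ennreal (poisson_kernel (of_real (\<rho> n) * \<zeta>) \<xi> * \<bar>h \<xi>\<bar>)
    \<partial>circle_measure)" for n \<zeta>
  note pair = poisson_kernel_measurable_pair[OF borel_measurable_integrable[OF h]]
  have U_measurable [measurable]: "U n \<in> borel_measurable circle_measure" for n
    unfolding U_def by (rule sigma_finite_measure.borel_measurable_nn_integral[OF
        prob_space_imp_sigma_finite[OF prob_space_circle_measure] pair])
  have mean: "(\<integral>\<^sup>+\<zeta>. U n \<zeta> \<partial>circle_measure) = (\<integral>\<^sup>+\<xi>. ennreal \<bar>h \<xi>\<bar> \<partial>circle_measure)" for n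
  proof -
    have "(\<integral>\<^sup>+\<zeta>. U n \<zeta> \<partial>circle_measure) = (\<integral>\<^sup>+\<xi>. (\<integral>\<^sup>+\<zeta>. ennreal (poisson_kernel
        (of_real (\<rho> n) * \<zeta>) \<xi> * \<bar>h \<xi>\<bar>) \<partial>circle_measure) \<partial>circle_measure)"
      unfolding U_def using Fubini'[OF pair[of "\<rho> n"]] by simp
    also have "\<dots> = (\<integral>\<^sup>+\<xi>. ennreal \<bar>h \<xi>\<bar> \<partial>circle_measure)"
    proof (rule nn_integral_cong)
      fix \<xi> assume "\<xi> \<in> space circle_measure"
      then have \<xi>: "norm \<xi> = 1" by simp
      have "(\<lambda>\<zeta>. ennreal (poisson_kernel (of_real (\<rho> n) * \<zeta>) \<xi>)) \<in> borel_measurable circle_measure"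
        unfolding poisson_kernel_def using id_measurable_circle by measurable
      then show "(\<integral>\<^sup>+\<zeta>. ennreal (poisson_kernel (of_real (\<rho> n) * \<zeta>) \<xi> * \<bar>h \<xi>\<bar>) \<partial>circle_measure)
          = ennreal \<bar>h \<xi>\<bar>"
        using poisson_kernel_circle_mean[OF \<rho> \<xi>, of n]
        by (simp add: ennreal_mult'' nn_integral_multc)
    qed
    finally show ?thesis .
  qed
  have "(\<integral>\<^sup>+\<zeta>. liminf (\<lambda>n. U n \<zeta>) \<partial>circle_measure) \<le> liminf (\<lambda>n. \<integral>\<^sup>+\<zeta>. U n \<zeta> \<partial>circle_measure)"
    by (rule nn_integral_liminf) measurable
  also have "\<dots> < \<infinity>"
    using h by (simp add: mean Liminf_const integrable_iff_bounded)
  finally have "AE \<zeta> in circle_measure. liminf (\<lambda>n. U n \<zeta>) \<noteq> \<infinity>"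
    by (intro nn_integral_PInf_AE) auto
  then show ?thesis
    unfolding U_def by eventually_elim (simp add: less_top)
qed

section \<open>Boundary values of outer functions\<close>

text \<open>The integral is the exponent in the representation of an outer function. Its integrand is
  integrable because the kernel is bounded in \<open>\<xi>\<close> for fixed \<open>z\<close>, so the real part may be taken
  under the integral sign, where the kernel becomes the positive Poisson kernel.\<close>

lemma abs_Re_Herglotz_integral_le:
  fixes h :: "complex \<Rightarrow> real"
  assumes h: "integrable circle_measure h" and z: "norm z < 1"
  shows "ennreal \<bar>Re (\<integral>\<xi>. (\<xi> + z) / (\<xi> - z) * complex_of_real (h \<xi>) \<partial>circle_measure)\<bar>
    \<le> (\<integral>\<^sup>+\<xi>. ennreal (poisson_kernel z \<xi> * \<bar>h \<xi>\<bar>) \<partial>circle_measure)"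
proof -
  note [measurable] = id_measurable_circle borel_measurable_integrable[OF h]
  have bound: "norm ((\<xi> + z) / (\<xi> - z)) \<le> 2 / (1 - norm z)" if "norm \<xi> = 1" for \<xi>
  proof -
    have "norm (\<xi> + z) \<le> 2" "1 - norm z \<le> norm (\<xi> - z)"
      using norm_triangle_ineq[of \<xi> z] norm_triangle_ineq2[of \<xi> z] that z by auto
    then show ?thesis
      using z unfolding norm_divide by (intro frac_le) auto
  qed
  have int: "integrable circle_measure (\<lambda>\<xi>. (\<xi> + z) / (\<xi> - z) * complex_of_real (h \<xi>))"
  proof (rule Bochner_Integration.integrable_bound)
    show "integrable circle_measure (\<lambda>\<xi>. 2 / (1 - norm z) * h \<xi>)"
      using h by simp
    show "AE \<xi> in circle_measure. norm ((\<xi> + z) / (\<xi> - z) * complex_of_real (h \<xi>))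
        \<le> norm (2 / (1 - norm z) * h \<xi>)"
    proof (rule AE_I2)
      fix \<xi> assume "\<xi> \<in> space circle_measure"
      then show "norm ((\<xi> + z) / (\<xi> - z) * complex_of_real (h \<xi>)) \<le> norm (2 / (1 - norm z) * h \<xi>)"
        using mult_right_mono[OF bound[of \<xi>], of "\<bar>h \<xi>\<bar>"] z
        by (simp add: norm_mult norm_divide abs_mult)
    qed
  qed measurable
  have Re: "Re (\<integral>\<xi>. (\<xi> + z) / (\<xi> - z) * complex_of_real (h \<xi>) \<partial>circle_measure)
      = (\<integral>\<xi>. poisson_kernel z \<xi> * h \<xi> \<partial>circle_measure)"
    unfolding integral_Re[OF int, symmetric] poisson_kernel_def
    by (simp del: times_divide_eq_left)
  have "integrable circle_measure (\<lambda>\<xi>. poisson_kernel z \<xi> * h \<xi>)"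
    using integrable_bounded_linear[OF bounded_linear_Re int] by (simp add: poisson_kernel_def del: times_divide_eq_left)
  from integral_norm_bound_ennreal[OF this] show ?thesis
    unfolding Re real_norm_def
    by (rule order_trans) (auto intro!: nn_integral_mono simp: abs_mult poisson_kernel_nonneg[OF z])
qed

text \<open>Along a radius on which \<open>G\<close> tends to 0, the Poisson integrals of \<open>|ln \<phi>|\<close>, which dominate
  \<open>- ln |G|\<close>, tend to infinity. This can happen only on a null set of radii.\<close>

lemma outer_function_boundary_values_nonzero:
  assumes outer: "outer_function G" and bv: "has_boundary_values G g"
  shows "AE \<zeta> in circle_measure. g \<zeta> \<noteq> 0"
proof -
  obtain c \<phi> where c: "norm c = 1" and h: "integrable circle_measure (\<lambda>\<zeta>. ln (\<phi> \<zeta>))"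
    and G: "\<And>z. norm z < 1 \<Longrightarrow> G z =
      c * exp (\<integral>\<zeta>. (\<zeta> + z) / (\<zeta> - z) * complex_of_real (ln (\<phi> \<zeta>)) \<partial>circle_measure)"
    using outer unfolding outer_function_def by auto
  \<comment> \<open>Any sequence of positive radii increasing to 1 serves; Fatou's lemma needs a countable one.\<close>
  define \<rho> :: "nat \<Rightarrow> real" where "\<rho> n = 1 - 1 / (real n + 2)" for n
  have \<rho>: "0 < \<rho> n" "\<rho> n < 1" for n
    by (simp_all add: \<rho>_def)
  have \<rho>_lim: "filterlim \<rho> (at_left 1) sequentially"
  proof -
    have "\<rho> \<longlonglongrightarrow> 1" unfolding \<rho>_def by real_asymp
    then show ?thesis
      unfolding filterlim_at using \<rho> by (auto intro: always_eventually simp: less_imp_neq)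
  qed
  define U where "U n \<zeta> = (\<integral>\<^sup>+\<xi>. ennreal (poisson_kernel (of_real (\<rho> n) * \<zeta>) \<xi> * \<bar>ln (\<phi> \<xi>)\<bar>)
    \<partial>circle_measure)" for n \<zeta>
  have G_lower: "ennreal (- ln (norm (G (of_real (\<rho> n) * \<zeta>)))) \<le> U n \<zeta>" if "norm \<zeta> = 1" for n \<zeta>
  proof -
    have "norm (of_real (\<rho> n) * \<zeta>) < 1"
      using that \<rho>[of n] by (simp add: norm_mult)
    from abs_Re_Herglotz_integral_le[OF h this] show ?thesis
      unfolding U_def G[OF \<open>norm (of_real (\<rho> n) * \<zeta>) < 1\<close>]
      by (rule order_trans[rotated]) (auto simp: norm_mult c intro!: ennreal_leI)
  qed
  have G_nz: "G z \<noteq> 0" if "norm z < 1" for z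
    using c G[OF that] by auto
  have "AE \<zeta> in circle_measure. liminf (\<lambda>n. U n \<zeta>) < \<infinity>"
    unfolding U_def by (rule AE_liminf_poisson_integral_finite[OF h \<rho>])
  with bv[unfolded has_boundary_values_def] AE_space show ?thesis
  proof eventually_elim
    fix \<zeta> assume lim: "((\<lambda>\<rho>. G (of_real \<rho> * \<zeta>)) \<longlongrightarrow> g \<zeta>) (at_left 1)"
      and "\<zeta> \<in> space circle_measure" and finite: "liminf (\<lambda>n. U n \<zeta>) < \<infinity>"
    then have \<zeta>: "norm \<zeta> = 1" by simp
    show "g \<zeta> \<noteq> 0"
    proof
      assume "g \<zeta> = 0"
      then have "(\<lambda>n. norm (G (of_real (\<rho> n) * \<zeta>))) \<longlonglongrightarrow> 0"
        using tendsto_norm[OF filterlim_compose[OF lim \<rho>_lim]] by simp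
      have large: "ennreal K \<le> liminf (\<lambda>n. U n \<zeta>)" for K
      proof (rule Liminf_bounded)
        have "eventually (\<lambda>n. norm (G (of_real (\<rho> n) * \<zeta>)) < exp (- K)) sequentially"
          by (rule order_tendstoD(2)[OF \<open>_ \<longlonglongrightarrow> 0\<close>]) simp
        then show "eventually (\<lambda>n. ennreal K \<le> U n \<zeta>) sequentially"
        proof eventually_elim
          fix n assume *: "norm (G (of_real (\<rho> n) * \<zeta>)) < exp (- K)"
          have "norm (of_real (\<rho> n) * \<zeta>) < 1"
            using \<zeta> \<rho>[of n] by (simp add: norm_mult)
          then have "0 < norm (G (of_real (\<rho> n) * \<zeta>))"
            using G_nz by simp
          then have "ln (norm (G (of_real (\<rho> n) * \<zeta>))) < - K"
            using * by (metis exp_less_cancel_iff exp_ln)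
          then show "ennreal K \<le> U n \<zeta>"
            by (intro order_trans[OF _ G_lower[OF \<zeta>]] ennreal_leI) simp
        qed
      qed
      obtain L where "liminf (\<lambda>n. U n \<zeta>) = ennreal L" "0 \<le> L"
        using finite by (metis ennreal_cases infinity_ennreal_def less_irrefl)
      with large[of "L + 1"] show False
        by simp
    qed
  qed
qed

section \<open>The embedding\<close>

text \<open>A crude form of Young's inequality: each factor grows when its base is replaced by the
  maximum of \<open>A\<close> and \<open>B\<close>.\<close>

lemma powr_mult_powr_le_add:
  fixes A B a b :: real
  assumes "0 \<le> A" "0 \<le> B" "0 \<le> a" "0 \<le> b" "a + b = 1"
  shows "A powr a * B powr b \<le> A + B"
proof -
  define M where "M = max A B"
  have "A powr a * B powr b \<le> M powr a * M powr b"
    using assms by (intro mult_mono powr_mono2) (auto simp: M_def)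
  also have "\<dots> = M"
    using assms by (auto simp: M_def simp flip: powr_add)
  also have "\<dots> \<le> A + B"
    using assms by (auto simp: M_def)
  finally show ?thesis .
qed

theorem proposition3:
  fixes p q r s :: real and g :: "complex \<Rightarrow> complex"
  assumes "1 < p" and "1 / p + 1 / q = 1"
    and "g \<in> Hardy_outer p"
    and "s > q" and "(\<lambda>\<zeta>. 1 / g \<zeta>) \<in> Lp circle_measure s"
    and "1 / r = 1 / p + 1 / s"
  shows "weighted_Lp circle_measure p (\<lambda>\<zeta>. norm (g \<zeta>) powr p) \<subseteq> Lp circle_measure r"
proof
  fix f assume "f \<in> weighted_Lp circle_measure p (\<lambda>\<zeta>. norm (g \<zeta>) powr p)"
  then have f [measurable]: "f \<in> borel_measurable circle_measure"
    and f_fin: "(\<integral>\<^sup>+\<zeta>. ennreal (norm (f \<zeta>) powr p * norm (g \<zeta>) powr p) \<partial>circle_measure) < \<infinity>"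
    by (auto simp: weighted_Lp_def)
  have inv [measurable]: "(\<lambda>\<zeta>. 1 / g \<zeta>) \<in> borel_measurable circle_measure"
    and inv_fin: "(\<integral>\<^sup>+\<zeta>. ennreal (norm (1 / g \<zeta>) powr s) \<partial>circle_measure) < \<infinity>"
    using assms(5) by (auto simp: Lp_def)
  \<comment> \<open>Since \<open>1 / (1 / w) = w\<close> for all \<open>w\<close>, zero included.\<close>
  have [measurable]: "g \<in> borel_measurable circle_measure"
    using borel_measurable_divide[OF borel_measurable_const[of 1] inv] by simp
  have "1 / p < 1"
    using assms(1) by simp
  with assms(2) have "1 / q > 0"
    by linarith
  then have "s > 0"
    using \<open>s > q\<close> by (simp add: zero_less_divide_iff)
  then have "1 / r > 0"
    using assms(1,6) by (simp add: add_pos_pos)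
  then have "r > 0" by (simp add: zero_less_divide_iff)
  have exponents: "r / p + r / s = 1"
    using arg_cong[OF assms(6), of "\<lambda>x. r * x"] \<open>r > 0\<close> by (simp add: distrib_left)
  have nz: "AE \<zeta> in circle_measure. g \<zeta> \<noteq> 0"
    using assms(3) outer_function_boundary_values_nonzero by (auto simp: Hardy_outer_def)
  have "(\<integral>\<^sup>+\<zeta>. ennreal (norm (f \<zeta>) powr r) \<partial>circle_measure)
      \<le> (\<integral>\<^sup>+\<zeta>. ennreal (norm (f \<zeta>) powr p * norm (g \<zeta>) powr p)
            + ennreal (norm (1 / g \<zeta>) powr s) \<partial>circle_measure)"
  proof (rule nn_integral_mono_AE, use nz in eventually_elim)
    fix \<zeta> assume "g \<zeta> \<noteq> 0"
    define A where "A = norm (f \<zeta>) powr p * norm (g \<zeta>) powr p"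
    define B where "B = norm (1 / g \<zeta>) powr s"
    have "norm (f \<zeta>) powr r = (norm (f \<zeta>) * norm (g \<zeta>)) powr r * norm (1 / g \<zeta>) powr r"
      using \<open>g \<zeta> \<noteq> 0\<close> by (simp add: norm_divide flip: powr_mult)
    also have "\<dots> = A powr (r / p) * B powr (r / s)"
      using \<open>1 < p\<close> \<open>s > 0\<close> by (simp add: A_def B_def powr_powr flip: powr_mult)
    also have "\<dots> \<le> A + B"
      using \<open>1 < p\<close> \<open>s > 0\<close> \<open>r > 0\<close> exponents
      by (intro powr_mult_powr_le_add) (auto simp: A_def B_def)
    finally show "ennreal (norm (f \<zeta>) powr r) \<le> ennreal (norm (f \<zeta>) powr p * norm (g \<zeta>) powr p)
        + ennreal (norm (1 / g \<zeta>) powr s)"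
      by (simp add: A_def B_def ennreal_leI flip: ennreal_plus)
  qed
  also have "\<dots> < \<infinity>"
    using f_fin inv_fin by (subst nn_integral_add) auto
  finally show "f \<in> Lp circle_measure r"
    using f by (simp add: Lp_def)
qed

end
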